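(* Let $\Sigma\in\mathbb{R}^{d\times d}$ be symmetric positive semidefinite (possibly singular), $\mathcal D=\mathcal N(0,\Sigma)$, $x^*\in\mathbb{S}^{d-1}$, let $\ell(u_1,u_2;x,x^* )$ be a loss, $\ell:\mathbb{R}\times\mathbb{R}\times\mathbb{R}^d\times\mathbb{R}^d\to\mathbb{R}$, locally Lipschitz in $u_1$, and let $g_\ell(x,x^* )=\mathbb{E}_{z\sim\mathcal D}[\partial_1\ell(x\cdot z,x^*\cdot z;x,x^* )(I-xx^\top)z]$. Let $x\in\mathbb{S}^{d-1}$ with $\theta=\theta(x,x^* )\in(0,\pi/2)$ and $v=x^*_{\perp x}/\|x^*_{\perp x}\|_2$, where $x^*_{\perp x}=(I-xx^\top)x^*$. Suppose there are reals $\mu^{(1)}_\theta,\mu^{(2)}_\theta\ge0$ (possibly depending on $\theta$) with $\mu^{(1)}_\theta+\mu^{(2)}_\theta>0$ such that $$\Big(\mathbb{E}_{z\sim\mathcal D}[D_1\partial_1\ell(x\cdot z,x^*\cdot z;x,x^* )]+\cos\theta\;\mathbb{E}_{z\sim\mathcal D}[D_2\partial_1\ell(x\cdot z,x^*\cdot z;x,x^* )]\Big)(x^\top\Sigma v)\le-\mu^{(1)}_\theta,$$ $$\mathbb{E}_{z\sim\mathcal D}[D_2\partial_1\ell(x\cdot z,x^*\cdot z;x,x^* )]\,(v^\top\Sigma v)\le-\mu^{(2)}_\theta .$$ Then: 1. If there is $L_1>0$ with $\|g_\ell(y,x^* )\|_2\le L_1$ for all $y\in\mathbb{S}^{d-1}$,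 then $\displaystyle g_\ell(x,x^* )\cdot x^*\le-\frac{\mu^{(1)}_\theta+\sin\theta\,\mu^{(2)}_\theta}{L_1}\,\sin\theta\,\|g_\ell(x,x^* )\|_2$. 2. If there is $L_2>0$ with $\|g_\ell(y,x^* )\|_2\le L_2\|y-x^*\|_2$ for all $y\in\mathbb{S}^{d-1}$, then $\displaystyle g_\ell(x,x^* )\cdot x^*\le-\frac{\mu^{(1)}_\theta+\sin\theta\,\mu^{(2)}_\theta}{2L_2}\,\|g_\ell(x,x^* )\|_2$.
   Context: $\mathbb{S}^{d-1}$ is the unit sphere of $\mathbb{R}^d$; $\theta(x,y)=\arccos(x\cdot y)$ for unit vectors. $\partial_1\ell$ is the derivative of $\ell$ in its first argument; where $\ell$ is not differentiable it denotes one fixed measurable, integrable single-valued selection from the Clarke subdifferential in that argument. $D_1,D_2$ denote distributional (weak) derivatives of this selection in its first and second arguments. All displayed expectations are assumed finite. Expectations of distributional derivatives are understood through the standard Gaussian representation $z=\Sigma^{1/2}p$, $p\sim\mathcal N(0,I_d)$: $\mathbb{E}_{z\sim\mathcal D}[D_i\partial_1\ell(x\cdot z,x^*\cdot z;x,x^* )]$ is the pairing of the distribution $D_i\partial_1\ell((\Sigma^{1/2}x)^\top p,(\Sigma^{1/2}x^* )^\top p;x,x^* )$ in $p$ with the standard Gaussian density. Standing assumption: with $G(p)=\partial_1\ell((\Sigma^{1/2}x)^\top p,(\Sigma^{1/2}x^* )^\top p;x,x^* )$, $G$ is integrable, $\mathbb{E}[G(p)p]$ exists, $G$ has a distributional gradient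 so that Stein's identity $\mathbb{E}[G(p)p]=\mathbb{E}[DG(p)]$ applies, and the distributional chain rule $D_pG=D_1\partial_1\ell(\cdot)\,\Sigma^{1/2}x+D_2\partial_1\ell(\cdot)\,\Sigma^{1/2}x^*$ holds with all resulting Gaussian pairings finite. *)

theory Defs
  imports "HOL-Probability.Probability"
begin

section \<open>Gaussian measures\<close>

definition pos_semidef :: "real^'n^'n \<Rightarrow> bool" where
  "pos_semidef A \<longleftrightarrow> transpose A = A \<and> (\<forall>w. 0 \<le> w \<bullet> (A *v w))"

text \<open>The unique symmetric positive semidefinite square root of a symmetric positive
  semidefinite matrix.\<close>

definition psd_sqrt :: "real^'n^'n \<Rightarrow> real^'n^'n" where
  "psd_sqrt A = (THE R. pos_semidef R \<and> R ** R = A)"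

definition std_gaussian_density :: "'a::euclidean_space \<Rightarrow> real" where
  "std_gaussian_density p = (\<Prod>b\<in>Basis. std_normal_density (p \<bullet> b))"

definition std_gaussian :: "'a::euclidean_space measure" where
  "std_gaussian = density lborel (\<lambda>p. ennreal (std_gaussian_density p))"

text \<open>The covariance may be singular, so the centred Gaussian is given by its standard
  representation and not by a density.\<close>

definition gaussian :: "real^'n^'n \<Rightarrow> (real^'n) measure" where
  "gaussian Cov = distr std_gaussian borel (\<lambda>p. psd_sqrt Cov *v p)"


section \<open>Distributions\<close>

text \<open>A distribution is represented by its action on test functions; its values on other
  arguments are irrelevant.\<close>

primrec Ck :: "nat \<Rightarrow> ('a::euclidean_space \<Rightarrow> real) \<Rightarrow> bool" where
  "Ck 0 f \<longleftrightarrow> continuous_on UNIV f"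
| "Ck (Suc k) f \<longleftrightarrow> f differentiable_on UNIV \<and>
     (\<forall>b\<in>Basis. Ck k (\<lambda>x. frechet_derivative f (at x) b))"

definition test_function :: "('a::euclidean_space \<Rightarrow> real) \<Rightarrow> bool" where
  "test_function \<psi> \<longleftrightarrow> (\<forall>k. Ck k \<psi>) \<and> compact (closure {x. \<psi> x \<noteq> 0})"

definition locally_integrable :: "('a::euclidean_space \<Rightarrow> real) \<Rightarrow> bool" where
  "locally_integrable f \<longleftrightarrow> (\<forall>K. compact K \<longrightarrow> set_integrable lborel K f)"

definition regular_distr :: "('a::euclidean_space \<Rightarrow> real) \<Rightarrow> ('a \<Rightarrow> real) \<Rightarrow> real" where
  "regular_distr f \<psi> = (\<integral>x. f x * \<psi> x \<partial>lborel)"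

definition distr_deriv ::
  "'a::euclidean_space \<Rightarrow> (('a \<Rightarrow> real) \<Rightarrow> real) \<Rightarrow> ('a \<Rightarrow> real) \<Rightarrow> real" where
  "distr_deriv b T \<psi> = - T (\<lambda>x. frechet_derivative \<psi> (at x) b)"

text \<open>The composition \<open>T \<circ> A\<close> of a distribution with a linear map is the distributional limit
  of \<open>(T * \<rho>\<^sub>\<epsilon>) \<circ> A\<close> as \<open>\<epsilon> \<rightarrow> 0\<close>, required to be the same for every mollifier
  \<open>\<rho>\<close>. For surjective \<open>A\<close> this is the usual pullback, which then always exists; for
  continuous functions it is ordinary composition. For \<open>A\<close> not surjective (which
  occurs for singular covariances) existence is a genuine condition.\<close>

definition mollifier :: "('a::euclidean_space \<Rightarrow> real) \<Rightarrow> bool" where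
  "mollifier \<rho> \<longleftrightarrow> test_function \<rho> \<and> (\<forall>u. 0 \<le> \<rho> u) \<and> (\<integral>u. \<rho> u \<partial>lborel) = 1"

definition mollify ::
  "('a::euclidean_space \<Rightarrow> real) \<Rightarrow> real \<Rightarrow> (('a \<Rightarrow> real) \<Rightarrow> real) \<Rightarrow> 'a \<Rightarrow> real" where
  "mollify \<rho> \<epsilon> T u = T (\<lambda>w. \<rho> ((u - w) /\<^sub>R \<epsilon>) / \<epsilon> ^ DIM('a))"

definition has_pullback_at ::
  "(('b::euclidean_space \<Rightarrow> real) \<Rightarrow> real) \<Rightarrow> ('a::euclidean_space \<Rightarrow> 'b) \<Rightarrow> ('a \<Rightarrow> real) \<Rightarrow> real \<Rightarrow> bool"
  where
  "has_pullback_at T A \<psi> c \<longleftrightarrow> (\<forall>\<rho>. mollifier \<rho> \<longrightarrow>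
     ((\<lambda>\<epsilon>. regular_distr (\<lambda>p. mollify \<rho> \<epsilon> T (A p)) \<psi>) \<longlongrightarrow> c) (at_right 0))"

definition pullback_exists ::
  "(('b::euclidean_space \<Rightarrow> real) \<Rightarrow> real) \<Rightarrow> ('a::euclidean_space \<Rightarrow> 'b) \<Rightarrow> bool" where
  "pullback_exists T A \<longleftrightarrow> (\<forall>\<psi>. test_function \<psi> \<longrightarrow> (\<exists>c. has_pullback_at T A \<psi> c))"

definition pullback ::
  "(('b::euclidean_space \<Rightarrow> real) \<Rightarrow> real) \<Rightarrow> ('a::euclidean_space \<Rightarrow> 'b) \<Rightarrow> ('a \<Rightarrow> real) \<Rightarrow> real" where
  "pullback T A \<psi> = (THE c. has_pullback_at T A \<psi> c)"

text \<open>The Gaussian density is not compactly supported, so the pairing of a distribution with it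
  is the limit of the pairings with the density truncated by \<open>\<eta>(p / r)\<close>, \<open>r \<rightarrow> \<infinity>\<close>,
  for every smooth cutoff \<open>\<eta>\<close> equal to 1 near the origin. If \<open>f\<close> is integrable for the
  standard Gaussian, the regular distribution of \<open>f\<close> has pairing \<open>E[f]\<close>.\<close>

definition has_gaussian_pairing :: "(('a::euclidean_space \<Rightarrow> real) \<Rightarrow> real) \<Rightarrow> real \<Rightarrow> bool" where
  "has_gaussian_pairing T c \<longleftrightarrow>
     (\<forall>\<eta>. test_function \<eta> \<and> (\<forall>\<^sub>F p in nhds 0. \<eta> p = 1) \<longrightarrow>
       ((\<lambda>r. T (\<lambda>p. \<eta> (p /\<^sub>R r) * std_gaussian_density p)) \<longlongrightarrow> c) at_top)"

definition gaussian_pairing_finite :: "(('a::euclidean_space \<Rightarrow> real) \<Rightarrow> real) \<Rightarrow> bool" where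
  "gaussian_pairing_finite T \<longleftrightarrow> (\<exists>c. has_gaussian_pairing T c)"

definition gaussian_pairing :: "(('a::euclidean_space \<Rightarrow> real) \<Rightarrow> real) \<Rightarrow> real" where
  "gaussian_pairing T = (THE c. has_gaussian_pairing T c)"


section \<open>Losses and selections from the Clarke subdifferential\<close>

definition clarke_dderiv :: "(real \<Rightarrow> real) \<Rightarrow> real \<Rightarrow> real \<Rightarrow> ereal" where
  "clarke_dderiv f u w =
     Limsup (nhds u \<times>\<^sub>F at_right 0) (\<lambda>(y, t). ereal ((f (y + t * w) - f y) / t))"

definition clarke_subdiff :: "(real \<Rightarrow> real) \<Rightarrow> real \<Rightarrow> real set" where
  "clarke_subdiff f u = {\<xi>. \<forall>w. ereal (\<xi> * w) \<le> clarke_dderiv f u w}"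

type_synonym 'n loss = "real \<Rightarrow> real \<Rightarrow> real^'n \<Rightarrow> real^'n \<Rightarrow> real"

text \<open>\<open>dl\<close> is a measurable version of the derivative of \<open>l\<close> in its first argument.\<close>

definition is_d1_selection :: "'n::finite loss \<Rightarrow> 'n loss \<Rightarrow> bool" where
  "is_d1_selection l dl \<longleftrightarrow>
     (\<forall>u1 u2 y ys. if (\<lambda>u. l u u2 y ys) differentiable (at u1)
        then ((\<lambda>u. l u u2 y ys) has_real_derivative dl u1 u2 y ys) (at u1)
        else dl u1 u2 y ys \<in> clarke_subdiff (\<lambda>u. l u u2 y ys) u1) \<and>
     (\<forall>y ys. (\<lambda>(u1, u2). dl u1 u2 y ys) \<in> borel_measurable borel)"

definition proj_perp :: "real^'n \<Rightarrow> real^'n^'n" where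
  "proj_perp x = mat 1 - (\<chi> i j. x $ i * x $ j)"

definition g_integrand :: "'n::finite loss \<Rightarrow> real^'n \<Rightarrow> real^'n \<Rightarrow> real^'n \<Rightarrow> real^'n" where
  "g_integrand dl x xs z = dl (x \<bullet> z) (xs \<bullet> z) x xs *\<^sub>R (proj_perp x *v z)"

definition g_loss :: "'n::finite loss \<Rightarrow> real^'n^'n \<Rightarrow> real^'n \<Rightarrow> real^'n \<Rightarrow> real^'n" where
  "g_loss dl Cov x xs = (\<integral>z. g_integrand dl x xs z \<partial>gaussian Cov)"

definition d1_sec :: "'n::finite loss \<Rightarrow> real^'n \<Rightarrow> real^'n \<Rightarrow> real \<times> real \<Rightarrow> real" where
  "d1_sec dl x xs = (\<lambda>(u1, u2). dl u1 u2 x xs)"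

definition index_map :: "real^'n^'n \<Rightarrow> real^'n \<Rightarrow> real^'n \<Rightarrow> real^'n \<Rightarrow> real \<times> real" where
  "index_map Cov x xs p = ((psd_sqrt Cov *v x) \<bullet> p, (psd_sqrt Cov *v xs) \<bullet> p)"

definition G_fun :: "'n::finite loss \<Rightarrow> real^'n^'n \<Rightarrow> real^'n \<Rightarrow> real^'n \<Rightarrow> real^'n \<Rightarrow> real" where
  "G_fun dl Cov x xs p = d1_sec dl x xs (index_map Cov x xs p)"

text \<open>The direction \<open>e\<close> is \<open>(1, 0)\<close> for \<open>D\<^sub>1\<close> and \<open>(0, 1)\<close> for \<open>D\<^sub>2\<close>. The derivative
  is taken on the plane, the result is pulled back to the space of \<open>p\<close>.\<close>

definition D_dl :: "real \<times> real \<Rightarrow> 'n::finite loss \<Rightarrow> real^'n \<Rightarrow> real^'n \<Rightarrow>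
    (real \<times> real \<Rightarrow> real) \<Rightarrow> real" where
  "D_dl e dl x xs = distr_deriv e (regular_distr (d1_sec dl x xs))"

definition D_dl_pulled :: "real \<times> real \<Rightarrow> 'n::finite loss \<Rightarrow> real^'n^'n \<Rightarrow> real^'n \<Rightarrow> real^'n \<Rightarrow>
    (real^'n \<Rightarrow> real) \<Rightarrow> real" where
  "D_dl_pulled e dl Cov x xs = pullback (D_dl e dl x xs) (index_map Cov x xs)"

definition E_D1 :: "'n::finite loss \<Rightarrow> real^'n^'n \<Rightarrow> real^'n \<Rightarrow> real^'n \<Rightarrow> real" where
  "E_D1 dl Cov x xs = gaussian_pairing (D_dl_pulled (1, 0) dl Cov x xs)"

definition E_D2 :: "'n::finite loss \<Rightarrow> real^'n^'n \<Rightarrow> real^'n \<Rightarrow> real^'n \<Rightarrow> real" where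
  "E_D2 dl Cov x xs = gaussian_pairing (D_dl_pulled (0, 1) dl Cov x xs)"


section \<open>The standing assumption\<close>

definition stein_identity :: "(real^'n \<Rightarrow> real) \<Rightarrow> bool" where
  "stein_identity G \<longleftrightarrow>
     (\<forall>b\<in>Basis. gaussian_pairing_finite (distr_deriv b (regular_distr G))) \<and>
     (\<integral>p. G p *\<^sub>R p \<partial>std_gaussian) =
       (\<Sum>b\<in>Basis. gaussian_pairing (distr_deriv b (regular_distr G)) *\<^sub>R b)"

definition chain_rule :: "'n::finite loss \<Rightarrow> real^'n^'n \<Rightarrow> real^'n \<Rightarrow> real^'n \<Rightarrow> bool" where
  "chain_rule dl Cov x xs \<longleftrightarrow>
     (\<forall>b\<in>Basis. \<forall>\<psi>. test_function \<psi> \<longrightarrow>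
        distr_deriv b (regular_distr (G_fun dl Cov x xs)) \<psi> =
          D_dl_pulled (1, 0) dl Cov x xs \<psi> * ((psd_sqrt Cov *v x) \<bullet> b) +
          D_dl_pulled (0, 1) dl Cov x xs \<psi> * ((psd_sqrt Cov *v xs) \<bullet> b))"

text \<open>Local integrability makes the derivatives of \<open>d1_sec\<close> on the plane meaningful; when the
  index map is not surjective it does not follow from integrability of \<open>G_fun\<close>.\<close>

definition standing_assumption :: "'n::finite loss \<Rightarrow> real^'n^'n \<Rightarrow> real^'n \<Rightarrow> real^'n \<Rightarrow> bool" where
  "standing_assumption dl Cov x xs \<longleftrightarrow>
     locally_integrable (d1_sec dl x xs) \<and>
     integrable std_gaussian (G_fun dl Cov x xs) \<and>
     integrable std_gaussian (\<lambda>p. G_fun dl Cov x xs p *\<^sub>R p) \<and>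
     stein_identity (G_fun dl Cov x xs) \<and>
     pullback_exists (D_dl (1, 0) dl x xs) (index_map Cov x xs) \<and>
     pullback_exists (D_dl (0, 1) dl x xs) (index_map Cov x xs) \<and>
     chain_rule dl Cov x xs \<and>
     gaussian_pairing_finite (D_dl_pulled (1, 0) dl Cov x xs) \<and>
     gaussian_pairing_finite (D_dl_pulled (0, 1) dl Cov x xs)"

end

theory Submission
  imports Defs
begin

text \<open>
  Write \<open>S\<close> for the positive semidefinite square root of the covariance \<open>\<Sigma>\<close>, \<open>P\<close> for the orthogonal
  projection onto the complement of \<open>x\<close>, and \<open>G\<close> for the derivative of the loss as a function of
  the standard Gaussian vector \<open>p\<close>. Since \<open>P\<close> and \<open>S\<close> are symmetric,
  \<open>g(x) \<bullet> xs = E[G(p) p] \<bullet> S P xs\<close>. Stein's identity and the chain rule turn the expectation into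
  \<open>E[D\<^sub>1] S x + E[D\<^sub>2] S xs\<close> (\<open>stein_gradient\<close>), and \<open>S S = \<Sigma>\<close> gives
  \<open>g(x) \<bullet> xs = E[D\<^sub>1] x \<bullet> \<Sigma> P xs + E[D\<^sub>2] xs \<bullet> \<Sigma> P xs\<close> (\<open>g_loss_inner\<close>). Now \<open>P xs = sin \<theta> v\<close> and
  \<open>xs = cos \<theta> x + sin \<theta> v\<close>, so the two hypotheses on the expectations yield
  \<open>g(x) \<bullet> xs \<le> - (\<mu>1 + sin \<theta> \<mu>2) sin \<theta>\<close>. The first conclusion follows from
  \<open>\<parallel>g(x)\<parallel> / L1 \<le> 1\<close>, the second from \<open>\<parallel>g(x)\<parallel> \<le> L2 \<parallel>x - xs\<parallel> \<le> 2 L2 sin \<theta>\<close>, where the last step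
  uses that \<open>\<theta>\<close> is acute.

  Three facts make the definite descriptions in the definitions meaningful and the chain rule
  applicable. A positive semidefinite matrix has exactly one positive semidefinite square root
  (\<open>psd_sqrt\<close>). A smooth cutoff exists (\<open>smooth_cutoff_exists\<close>), so that a distribution has at most
  one Gaussian pairing. The truncated Gaussian density is a test function
  (\<open>test_function_truncated_gaussian\<close>), so that the chain rule, an identity between values on test
  functions, passes to Gaussian pairings. The pullback to the space of \<open>p\<close> enters only through the
  chain rule and the finiteness of its Gaussian pairings; its construction is never unfolded.
\<close>

section \<open>Positive semidefinite square roots\<close>

lemma outer_product_mult:
  fixes x w :: "real^'n"
  shows "(\<chi> i j. x $ i * x $ j) *v w = (x \<bullet> w) *\<^sub>R x"
  by (simp add: matrix_vector_mult_def vec_eq_iff inner_vec_def sum_distrib_left mult.commute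
      mult.left_commute)

lemma pos_semidef_selfadjoint:
  fixes A :: "real^'n^'n"
  assumes "pos_semidef A"
  shows "x \<bullet> (A *v y) = (A *v x) \<bullet> y"
  using assms unfolding pos_semidef_def
  by (metis dot_lmul_matrix transpose_matrix_vector)

lemma pos_semidefI:
  fixes A :: "real^'n^'n"
  assumes sym: "\<And>x y. x \<bullet> (A *v y) = (A *v x) \<bullet> y"
    and nonneg: "\<And>w. 0 \<le> w \<bullet> (A *v w)"
  shows "pos_semidef A"
proof -
  have "transpose A *v y = A *v y" for y
  proof -
    have "(transpose A *v y) \<bullet> z = (A *v y) \<bullet> z" for z
      by (metis dot_lmul_matrix transpose_matrix_vector sym)
    then show ?thesis
      by (metis vector_eq_rdot)
  qed
  then have "transpose A = A"
    by (simp add: matrix_eq)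
  with nonneg show ?thesis
    by (simp add: pos_semidef_def)
qed

text \<open>An isotropic vector of a positive semidefinite form minimises the form, so it lies in the
  kernel.\<close>

lemma pos_semidef_isotropic_kernel:
  fixes A :: "real^'n^'n"
  assumes A: "pos_semidef A" and w: "w \<bullet> (A *v w) = 0"
  shows "A *v w = 0"
proof (rule ccontr)
  assume nz: "A *v w \<noteq> 0"
  define y where "y = A *v w"
  define n where "n = y \<bullet> y"
  define c where "c = y \<bullet> (A *v y)"
  have n: "n > 0" using nz by (simp add: n_def y_def)
  have c: "c \<ge> 0" using A by (simp add: c_def pos_semidef_def)
  have "0 \<le> 2 * t * n + t\<^sup>2 * c" for t
  proof -
    have "w \<bullet> (A *v y) = n"
      using pos_semidef_selfadjoint[OF A, of w y] by (simp add: n_def y_def)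
    moreover have "0 \<le> (w + t *\<^sub>R y) \<bullet> (A *v (w + t *\<^sub>R y))"
      using A by (simp add: pos_semidef_def)
    ultimately show ?thesis
      using w
      by (simp add: matrix_vector_right_distrib matrix_vector_mult_scaleR inner_add_left
          inner_add_right c_def n_def y_def[symmetric] power2_eq_square algebra_simps)
  qed
  \<comment> \<open>The shift by \<open>1\<close> keeps the denominator nonzero when \<open>c = 0\<close>.\<close>
  from this[of "- n / (c + 1)"] have "0 \<le> 2 * (- n / (c + 1)) * n + (- n / (c + 1))\<^sup>2 * c" .
  also have "\<dots> = - (n\<^sup>2 * (c + 2)) / (c + 1)\<^sup>2"
    using c by (simp add: divide_simps power2_eq_square) (simp add: algebra_simps)
  also have "\<dots> < 0"
    using n c by (simp add: divide_simps)
  finally show False by simp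
qed

text \<open>The maximum of the quadratic form on the unit sphere is attained at an eigenvector, because
  the maximiser is isotropic for the positive semidefinite form of \<open>\<kappa> I - A\<close>.\<close>

lemma pos_semidef_nonzero_eigenvector:
  fixes A :: "real^'n^'n"
  assumes A: "pos_semidef A" and nz: "A \<noteq> 0"
  obtains \<kappa> u where "\<kappa> > 0" "norm u = 1" "A *v u = \<kappa> *\<^sub>R u"
proof -
  have "continuous_on (sphere 0 1) (\<lambda>w. w \<bullet> (A *v w))"
    by (intro continuous_intros)
  moreover have "sphere (0 :: real^'n) 1 \<noteq> {}"
    by simp
  ultimately obtain u where u: "u \<in> sphere 0 1"
    and max: "\<And>w. w \<in> sphere 0 1 \<Longrightarrow> w \<bullet> (A *v w) \<le> u \<bullet> (A *v u)"
    using continuous_attains_sup[of "sphere 0 1" "\<lambda>w. w \<bullet> (A *v w)"] compact_sphere by blast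
  define \<kappa> where "\<kappa> = u \<bullet> (A *v u)"
  have bound: "w \<bullet> (A *v w) \<le> \<kappa> * (w \<bullet> w)" for w
  proof (cases "w = 0")
    case False
    have "(w /\<^sub>R norm w) \<bullet> (A *v (w /\<^sub>R norm w)) \<le> \<kappa>"
      unfolding \<kappa>_def using False by (intro max) simp
    then have "w \<bullet> (A *v w) / (norm w)\<^sup>2 \<le> \<kappa>"
      by (simp add: matrix_vector_mult_scaleR power2_eq_square divide_simps)
    with False show ?thesis
      by (simp add: divide_simps dot_square_norm)
  qed simp
  define B where "B = \<kappa> *\<^sub>R mat 1 - A"
  have Bw: "B *v w = \<kappa> *\<^sub>R w - A *v w" for w
    by (simp add: B_def matrix_vector_mult_diff_rdistrib scaleR_matrix_vector_assoc[symmetric])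
  have "pos_semidef B"
    by (rule pos_semidefI)
      (use bound pos_semidef_selfadjoint[OF A] in
        \<open>simp_all add: Bw inner_diff_left inner_diff_right\<close>)
  moreover have "u \<bullet> (B *v u) = 0"
    using u by (simp add: Bw inner_diff_right \<kappa>_def dot_square_norm)
  ultimately have "B *v u = 0"
    by (rule pos_semidef_isotropic_kernel)
  then have eig: "A *v u = \<kappa> *\<^sub>R u"
    by (simp add: Bw)
  have "\<kappa> \<noteq> 0"
  proof
    assume "\<kappa> = 0"
    then have "w \<bullet> (A *v w) = 0" for w
      using bound[of w] A by (simp add: pos_semidef_def order_antisym)
    then have "A *v w = 0 *v w" for w
      using pos_semidef_isotropic_kernel[OF A] by simp
    then show False
      using nz by (simp add: matrix_eq)
  qed
  moreover have "\<kappa> \<ge> 0"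
    using A by (simp add: \<kappa>_def pos_semidef_def)
  ultimately show thesis
    using that[of \<kappa> u] u eig by auto
qed

text \<open>Deflation: subtracting \<open>\<kappa> u u\<^sup>T\<close> for a unit eigenvector \<open>u\<close> enlarges the kernel, and any
  positive semidefinite root of the deflated matrix annihilates \<open>u\<close>.\<close>

lemma pos_semidef_sqrt_exists:
  fixes A :: "real^'n^'n"
  assumes "pos_semidef A"
  shows "\<exists>R. pos_semidef R \<and> R ** R = A"
  using assms
proof (induction "CARD('n) - dim {w. A *v w = 0}" arbitrary: A rule: less_induct)
  case less
  note A = less.prems
  show ?case
  proof (cases "A = 0")
    case True
    then have "pos_semidef (0 :: real^'n^'n)" "(0 :: real^'n^'n) ** 0 = A"
      using A by simp_all
    then show ?thesis by blast
  next
    case False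
    obtain \<kappa> u where \<kappa>: "\<kappa> > 0" and u: "norm u = 1" and eig: "A *v u = \<kappa> *\<^sub>R u"
      using pos_semidef_nonzero_eigenvector[OF A False] by blast
    have uu: "u \<bullet> u = 1"
      using u by (simp add: dot_square_norm)
    define U :: "real^'n^'n" where "U = (\<chi> i j. u $ i * u $ j)"
    have Uw: "U *v w = (u \<bullet> w) *\<^sub>R u" for w
      by (simp add: U_def outer_product_mult)
    \<comment> \<open>\<open>U\<close> is the matrix \<open>u u\<^sup>T\<close>.\<close>
    define A' where "A' = A - \<kappa> *\<^sub>R U"
    have A'w: "A' *v w = A *v w - (\<kappa> * (u \<bullet> w)) *\<^sub>R u" for w
      by (simp add: A'_def matrix_vector_mult_diff_rdistrib scaleR_matrix_vector_assoc[symmetric] Uw)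
    have uA: "u \<bullet> (A *v w) = \<kappa> * (u \<bullet> w)" for w
      using pos_semidef_selfadjoint[OF A, of u w] eig by simp
    have A': "pos_semidef A'"
    proof (rule pos_semidefI)
      show "x \<bullet> (A' *v y) = (A' *v x) \<bullet> y" for x y
        using pos_semidef_selfadjoint[OF A, of x y]
        by (simp add: A'w inner_diff_left inner_diff_right inner_commute)
    next
      fix w
      have "0 \<le> (w - (u \<bullet> w) *\<^sub>R u) \<bullet> (A *v (w - (u \<bullet> w) *\<^sub>R u))"
        using A by (simp add: pos_semidef_def)
      also have "\<dots> = w \<bullet> (A' *v w)"
        by (simp add: A'w matrix_vector_mult_diff_distrib matrix_vector_mult_scaleR eig uA uu
            inner_diff_left inner_diff_right inner_commute[of w u] algebra_simps)
      finally show "0 \<le> w \<bullet> (A' *v w)" .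
    qed
    have A'u: "A' *v u = 0"
      by (simp add: A'w eig uu)
    have sub: "{w. A *v w = 0} \<subset> {w. A' *v w = 0}"
    proof
      show "{w. A *v w = 0} \<subseteq> {w. A' *v w = 0}"
      proof clarify
        fix w assume "A *v w = 0"
        then show "A' *v w = 0"
          using uA[of w] \<kappa> by (simp add: A'w)
      qed
      show "{w. A *v w = 0} \<noteq> {w. A' *v w = 0}"
      proof
        assume "{w. A *v w = 0} = {w. A' *v w = 0}"
        then have "A *v u = 0"
          using A'u by blast
        then show False
          using eig \<kappa> u by auto
      qed
    qed
    have subspace_ker: "subspace {w. M *v w = 0}" for M :: "real^'n^'n"
      by (auto simp: subspace_def matrix_vector_right_distrib matrix_vector_mult_scaleR)
    have "dim {w. A *v w = 0} < dim {w. A' *v w = 0}"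
      using sub subspace_ker by (intro dim_psubset) (simp add: span_eq_iff[THEN iffD2])
    moreover have "dim {w. A' *v w = 0} \<le> CARD('n)"
      using dim_subset_UNIV[of "{w. A' *v w = 0}"] by simp
    ultimately have "CARD('n) - dim {w. A' *v w = 0} < CARD('n) - dim {w. A *v w = 0}"
      by linarith
    from less.hyps[OF this A'] obtain R' where R': "pos_semidef R'" and RR': "R' ** R' = A'"
      by blast
    have R'R'w: "R' *v (R' *v w) = A' *v w" for w
      by (simp add: matrix_vector_mul_assoc RR')
    have "(R' *v u) \<bullet> (R' *v u) = 0"
      using pos_semidef_selfadjoint[OF R', of u "R' *v u"] R'R'w[of u] A'u by simp
    then have R'u: "R' *v u = 0"
      by simp
    then have uR': "u \<bullet> (R' *v w) = 0" for w
      using pos_semidef_selfadjoint[OF R', of u w] by simp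
    define R where "R = R' + sqrt \<kappa> *\<^sub>R U"
    have Rw: "R *v w = R' *v w + (sqrt \<kappa> * (u \<bullet> w)) *\<^sub>R u" for w
      by (simp add: R_def matrix_vector_mult_add_rdistrib scaleR_matrix_vector_assoc[symmetric] Uw)
    have "pos_semidef R"
    proof (rule pos_semidefI)
      show "x \<bullet> (R *v y) = (R *v x) \<bullet> y" for x y
        using pos_semidef_selfadjoint[OF R', of x y]
        by (simp add: Rw inner_add_left inner_add_right inner_commute)
      show "0 \<le> w \<bullet> (R *v w)" for w
        using R' \<kappa>
        by (simp add: Rw inner_add_right inner_commute[of w u] pos_semidef_def mult.assoc)
    qed
    moreover have "(R ** R) *v w = A *v w" for w
    proof -
      have "(R ** R) *v w = R *v (R *v w)"
        by (simp add: matrix_vector_mul_assoc)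
      also have "\<dots> = A' *v w + (\<kappa> * (u \<bullet> w)) *\<^sub>R u"
        using \<kappa> by (simp add: Rw matrix_vector_right_distrib matrix_vector_mult_scaleR R'u uR' uu
            R'R'w inner_add_right)
      finally show ?thesis by (simp add: A'w)
    qed
    then have "R ** R = A"
      by (simp add: matrix_eq)
    ultimately show ?thesis by blast
  qed
qed

text \<open>With \<open>D = R - Q\<close>, equality of the squares reads \<open>R D + D Q = 0\<close>. Multiplying by \<open>D\<close> and taking
  traces gives \<open>tr (D R D) + tr (D Q D) = 0\<close>, a sum of nonnegative terms.\<close>

lemma pos_semidef_sqrt_unique:
  fixes R Q :: "real^'n^'n"
  assumes R: "pos_semidef R" and Q: "pos_semidef Q" and eq: "R ** R = Q ** Q"
  shows "R = Q"
proof -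
  define D where "D = R - Q"
  have Dw: "D *v w = R *v w - Q *v w" for w
    by (simp add: D_def matrix_vector_mult_diff_rdistrib)
  have Dsym: "x \<bullet> (D *v y) = (D *v x) \<bullet> y" for x y
    using pos_semidef_selfadjoint[OF R] pos_semidef_selfadjoint[OF Q]
    by (simp add: Dw inner_diff_left inner_diff_right)
  have tr: "trace (D ** M ** D) = (\<Sum>i\<in>UNIV. (D *v axis i 1) \<bullet> (M *v (D *v axis i 1)))" for M
  proof -
    have "(D ** M ** D) $ i $ i = axis i 1 \<bullet> ((D ** M ** D) *v axis i 1)" for i
      by (simp add: matrix_vector_mult_basis column_def inner_axis')
    also have "\<dots> i = (D *v axis i 1) \<bullet> (M *v (D *v axis i 1))" for i
      by (simp add: matrix_vector_mul_assoc[symmetric] Dsym)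
    finally show ?thesis
      by (simp add: trace_def)
  qed
  have "D ** (R ** D) + D ** (D ** Q) = 0"
  proof -
    have "(D ** (R ** D) + D ** (D ** Q)) *v w = D *v ((R ** R - Q ** Q) *v w)" for w
      by (simp add: matrix_vector_mult_add_rdistrib matrix_vector_mult_diff_rdistrib
          matrix_vector_mul_assoc[symmetric] Dw matrix_vector_mult_diff_distrib)
    then show ?thesis
      using eq by (simp add: matrix_eq)
  qed
  then have "trace (D ** (R ** D)) + trace (D ** (D ** Q)) = 0"
    by (metis trace_add trace_0 mat_0)
  moreover have "trace (D ** (D ** Q)) = trace (D ** Q ** D)"
    by (rule trace_mul_sym)
  ultimately have sum0: "trace (D ** R ** D) + trace (D ** Q ** D) = 0"
    by (simp add: matrix_mul_assoc)
  have nonneg: "0 \<le> (D *v axis i 1) \<bullet> (M *v (D *v axis i 1))" if "pos_semidef M" for M i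
    using that by (simp add: pos_semidef_def)
  have "0 \<le> trace (D ** R ** D)" "0 \<le> trace (D ** Q ** D)"
    unfolding tr using nonneg[OF R] nonneg[OF Q] by (simp_all add: sum_nonneg)
  with sum0 have "trace (D ** R ** D) = 0" "trace (D ** Q ** D) = 0"
    by linarith+
  then have "(D *v axis i 1) \<bullet> (R *v (D *v axis i 1)) = 0"
    "(D *v axis i 1) \<bullet> (Q *v (D *v axis i 1)) = 0" for i
    using nonneg[OF R] nonneg[OF Q] unfolding tr by (simp_all add: sum_nonneg_eq_0_iff)
  then have "R *v (D *v axis i 1) = 0" "Q *v (D *v axis i 1) = 0" for i
    using pos_semidef_isotropic_kernel R Q by blast+
  \<comment> \<open>\<open>R\<close> and \<open>Q\<close> both annihilate the range of \<open>D\<close>, hence so does \<open>D\<close>, and \<open>D\<close> is symmetric.\<close>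
  then have "D *v (D *v axis i 1) = 0" for i
    by (simp add: Dw)
  then have "(D *v axis i 1) \<bullet> (D *v axis i 1) = 0" for i
    using Dsym[of "axis i 1" "D *v axis i 1"] by simp
  then have "D *v axis i 1 = 0" for i
    by simp
  then have "D = 0"
    by (simp add: matrix_vector_mult_basis column_def vec_eq_iff)
  then show ?thesis by (simp add: D_def)
qed

lemma psd_sqrt:
  fixes A :: "real^'n^'n"
  assumes "pos_semidef A"
  shows pos_semidef_psd_sqrt: "pos_semidef (psd_sqrt A)"
    and psd_sqrt_square: "psd_sqrt A ** psd_sqrt A = A"
proof -
  have "\<exists>!R. pos_semidef R \<and> R ** R = A"
    using pos_semidef_sqrt_exists[OF assms] pos_semidef_sqrt_unique by metis
  from theI'[OF this] show "pos_semidef (psd_sqrt A)" "psd_sqrt A ** psd_sqrt A = A"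
    by (simp_all add: psd_sqrt_def)
qed

section \<open>Calculus of smooth functions\<close>

lemma Ck_SucI:
  assumes "\<And>x. (f has_derivative f' x) (at x)" "\<And>b. b \<in> Basis \<Longrightarrow> Ck k (\<lambda>x. f' x b)"
  shows "Ck (Suc k) f"
proof -
  have "frechet_derivative f (at x) = f' x" for x
    using frechet_derivative_at[OF assms(1)] by simp
  with assms show ?thesis
    by (auto simp: differentiable_on_def differentiable_def)
qed

lemma Ck_Suc_has_derivative:
  assumes "Ck (Suc k) f"
  shows "(f has_derivative frechet_derivative f (at x)) (at x)"
  using assms by (auto simp: differentiable_on_def frechet_derivative_works)

lemma Ck_Suc_frechet:
  assumes "Ck (Suc k) f" "b \<in> Basis"
  shows "Ck k (\<lambda>x. frechet_derivative f (at x) b)"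
  using assms by simp

lemma Ck_Suc_imp_Ck: "Ck (Suc k) f \<Longrightarrow> Ck k f"
proof (induction k arbitrary: f)
  case 0
  then show ?case
    by (auto intro: differentiable_imp_continuous_on)
next
  case (Suc k)
  show ?case
    by (rule Ck_SucI[OF Ck_Suc_has_derivative[OF Suc.prems]])
      (use Suc.IH Ck_Suc_frechet[OF Suc.prems] in blast)
qed

lemma Ck_const: "Ck k (\<lambda>x. c)"
proof (induction k arbitrary: c)
  case (Suc k)
  show ?case
    by (rule Ck_SucI[where f' = "\<lambda>_ _. 0"]) (auto intro: Suc)
qed simp

lemma Ck_inner_left: "Ck k (\<lambda>x. x \<bullet> a)"
proof (cases k)
  case (Suc k')
  show ?thesis
    unfolding Suc by (rule Ck_SucI[where f' = "\<lambda>_ h. h \<bullet> a"])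
      (auto intro!: derivative_eq_intros Ck_const)
qed (auto intro: continuous_intros)

lemma Ck_add:
  "Ck k f \<Longrightarrow> Ck k g \<Longrightarrow> Ck k (\<lambda>x. f x + g x)"
proof (induction k arbitrary: f g)
  case (Suc k)
  show ?case
    by (rule Ck_SucI[OF has_derivative_add[OF Suc.prems[THEN Ck_Suc_has_derivative]]])
      (use Suc.IH Suc.prems[THEN Ck_Suc_frechet] in blast)
qed (auto intro: continuous_intros)

lemma Ck_mult:
  "Ck k f \<Longrightarrow> Ck k g \<Longrightarrow> Ck k (\<lambda>x. f x * g x)"
proof (induction k arbitrary: f g)
  case (Suc k)
  show ?case
    by (rule Ck_SucI[OF has_derivative_mult[OF Suc.prems[THEN Ck_Suc_has_derivative]]])
      (intro Ck_add Suc.IH Ck_Suc_imp_Ck[OF Suc.prems(1)] Ck_Suc_imp_Ck[OF Suc.prems(2)]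
        Suc.prems[THEN Ck_Suc_frechet]; assumption)
qed (auto intro: continuous_intros)

lemma Ck_diff:
  assumes "Ck k f" "Ck k g"
  shows "Ck k (\<lambda>x. f x - g x)"
  using Ck_add[OF assms(1) Ck_mult[OF Ck_const[of k "- 1"] assms(2)]] by simp

lemma Ck_inner_self: "Ck k (\<lambda>x. x \<bullet> x)"
proof (cases k)
  case (Suc k')
  show ?thesis
    unfolding Suc
  proof (rule Ck_SucI[where f' = "\<lambda>x h. 2 * (x \<bullet> h)"])
    show "((\<lambda>x. x \<bullet> x) has_derivative (\<lambda>h. 2 * (x \<bullet> h))) (at x)" for x :: 'a
      by (auto intro!: derivative_eq_intros simp: inner_commute)
  qed (intro Ck_mult Ck_const Ck_inner_left)
qed (auto intro: continuous_intros)

lemma Ck_scale_arg: "Ck k f \<Longrightarrow> Ck k (\<lambda>x. f (c *\<^sub>R x))"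
proof (induction k arbitrary: f)
  case (Suc k)
  have "((\<lambda>x. f (c *\<^sub>R x)) has_derivative (\<lambda>h. c * frechet_derivative f (at (c *\<^sub>R x)) h)) (at x)"
    for x
  proof -
    note f' = Ck_Suc_has_derivative[OF Suc.prems, of "c *\<^sub>R x"]
    have "((\<lambda>x. f (c *\<^sub>R x)) has_derivative (\<lambda>h. frechet_derivative f (at (c *\<^sub>R x)) (c *\<^sub>R h))) (at x)"
      by (rule has_derivative_compose[where f = "\<lambda>x. c *\<^sub>R x" and g = f, OF _ f']) (auto intro!: derivative_eq_intros)
    then show ?thesis
      using linear_cmul[OF has_derivative_linear[OF f']] by simp
  qed
  then show ?case
    by (rule Ck_SucI) (intro Ck_mult Ck_const Suc.IH Ck_Suc_frechet[OF Suc.prems]; assumption)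
next
  case 0
  then show ?case
    by (auto intro!: continuous_on_compose2[of UNIV f] continuous_intros)
qed

lemma Ck_compose:
  fixes \<phi> :: "real \<Rightarrow> real"
  shows "Ck k \<phi> \<Longrightarrow> Ck k f \<Longrightarrow> Ck k (\<lambda>x. \<phi> (f x))"
proof (induction k arbitrary: \<phi> f)
  case (Suc k)
  let ?D\<phi> = "\<lambda>t. frechet_derivative \<phi> (at t) 1"
  have "((\<lambda>x. \<phi> (f x)) has_derivative (\<lambda>h. ?D\<phi> (f x) * frechet_derivative f (at x) h)) (at x)" for x
  proof -
    note \<phi>' = Ck_Suc_has_derivative[OF Suc.prems(1), of "f x"]
    have lin: "frechet_derivative \<phi> (at (f x)) t = ?D\<phi> (f x) * t" for t
      using linear_cmul[OF has_derivative_linear[OF \<phi>'], of t 1] by (simp add: mult.commute)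
    show ?thesis
      by (rule has_derivative_eq_rhs
          [OF has_derivative_compose[OF Ck_Suc_has_derivative[OF Suc.prems(2)] \<phi>']])
        (rule ext, rule lin)
  qed
  moreover have "Ck k ?D\<phi>"
    using Ck_Suc_frechet[OF Suc.prems(1)] by simp
  then have "Ck k (\<lambda>x. ?D\<phi> (f x) * frechet_derivative f (at x) b)" if "b \<in> Basis" for b
    by (rule Ck_mult[OF Suc.IH[where \<phi> = ?D\<phi>, OF _ Ck_Suc_imp_Ck[OF Suc.prems(2)]]
          Ck_Suc_frechet[OF Suc.prems(2) that]])
  ultimately show ?case
    by (rule Ck_SucI)
next
  case 0
  then show ?case
    using continuous_on_compose2[of UNIV \<phi> UNIV f] by simp
qed

lemma Ck_exp: "Ck k (exp :: real \<Rightarrow> real)"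
proof (induction k)
  case (Suc k)
  show ?case
    by (rule Ck_SucI[where f' = "\<lambda>x h. exp x * h"])
      (auto intro!: derivative_eq_intros Suc)
qed (auto intro: continuous_intros)

section \<open>Cutoff functions\<close>

text \<open>The functions \<open>t\<^sup>-\<^sup>m exp (- 1 / t)\<close> for \<open>t > 0\<close>, extended by \<open>0\<close>. Their linear span is closed
  under differentiation, which makes each of them smooth.\<close>

definition flat_exp :: "nat \<Rightarrow> real \<Rightarrow> real" where
  "flat_exp m t = (if t > 0 then inverse t ^ m / exp (inverse t) else 0)"

lemma flat_exp_tendsto_0: "(flat_exp m \<longlongrightarrow> 0) (at 0)"
proof -
  have "((\<lambda>t. inverse t ^ m / exp (inverse t)) \<longlongrightarrow> 0) (at_right (0 :: real))"
    by (rule filterlim_compose[OF tendsto_power_div_exp_0 filterlim_inverse_at_top_right])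
  then have "(flat_exp m \<longlongrightarrow> 0) (at_right 0)"
    by (rule Lim_transform_eventually)
      (auto simp: flat_exp_def eventually_at_filter)
  moreover have "(flat_exp m \<longlongrightarrow> 0) (at_left 0)"
    by (rule Lim_transform_eventually[OF tendsto_const])
      (auto simp: flat_exp_def eventually_at_filter)
  ultimately show ?thesis
    by (simp add: filterlim_at_split)
qed

lemma flat_exp_has_derivative:
  "(flat_exp m has_real_derivative flat_exp (m + 2) t - real m * flat_exp (m + 1) t) (at t)"
proof -
  consider "t > 0" | "t < 0" | "t = 0" by linarith
  then show ?thesis
  proof cases
    case 1
    have "((\<lambda>t. inverse t ^ m * exp (- inverse t)) has_real_derivative
        - (real m * inverse t ^ (m - 1) * (inverse t)\<^sup>2 * exp (- inverse t)) +
          inverse t ^ m * exp (- inverse t) * (inverse t)\<^sup>2) (at t)"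
      using 1 by (auto intro!: derivative_eq_intros simp: power2_eq_square algebra_simps)
    also have "- (real m * inverse t ^ (m - 1) * (inverse t)\<^sup>2 * exp (- inverse t)) +
        inverse t ^ m * exp (- inverse t) * (inverse t)\<^sup>2 =
        flat_exp (m + 2) t - real m * flat_exp (m + 1) t"
      using 1 by (cases m)
        (simp_all add: flat_exp_def exp_minus divide_inverse power2_eq_square algebra_simps)
    finally have "((\<lambda>t. inverse t ^ m * exp (- inverse t)) has_real_derivative
        flat_exp (m + 2) t - real m * flat_exp (m + 1) t) (at t)" .
    then show ?thesis
      by (rule has_field_derivative_transform_within_open[of _ _ _ "{0<..}"])
        (use 1 in \<open>auto simp: flat_exp_def exp_minus divide_inverse\<close>)
  next
    case 2
    have "((\<lambda>t. 0) has_real_derivative flat_exp (m + 2) t - real m * flat_exp (m + 1) t) (at t)"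
      using 2 by (simp add: flat_exp_def)
    then show ?thesis
      by (rule has_field_derivative_transform_within_open[of _ _ _ "{..<0}"])
        (use 2 in \<open>auto simp: flat_exp_def\<close>)
  next
    case 3
    have "((\<lambda>h. (flat_exp m (0 + h) - flat_exp m 0) / h) \<longlongrightarrow> 0) (at 0)"
      by (rule Lim_transform_eventually[OF flat_exp_tendsto_0[of "m + 1"]])
        (auto simp: flat_exp_def eventually_at_filter field_simps)
    then show ?thesis
      using 3 by (simp add: DERIV_def flat_exp_def)
  qed
qed

lemma Ck_flat_exp: "Ck k (flat_exp m)"
proof (induction k arbitrary: m)
  case 0
  show ?case
    using DERIV_continuous_on[OF has_field_derivative_at_within[OF flat_exp_has_derivative]]
    by simp
next
  case (Suc k)
  have "(flat_exp m has_derivative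
      (\<lambda>h. (flat_exp (m + 2) t - real m * flat_exp (m + 1) t) * h)) (at t)" for t
    using flat_exp_has_derivative[of m t] by (simp add: has_field_derivative_def)
  then show ?case
    by (rule Ck_SucI) (intro Ck_mult Ck_diff Ck_const Suc.IH)
qed

text \<open>For \<open>h = flat_exp 0\<close> and \<open>a > 0\<close>, the function \<open>s \<mapsto> 1 - h (a - s) / h a\<close> is \<open>0\<close> at \<open>s = 0\<close> and \<open>1\<close>
  for \<open>s \<ge> a\<close>. Composed with \<open>h (1 - \<parallel>p\<parallel>\<^sup>2)\<close>, it gives a cutoff supported in the unit ball.\<close>

lemma smooth_cutoff_exists:
  "\<exists>\<eta> :: 'a::euclidean_space \<Rightarrow> real. test_function \<eta> \<and> (\<forall>\<^sub>F p in nhds 0. \<eta> p = 1)"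
proof -
  define h where "h = flat_exp 0"
  have h_pos: "h t > 0" if "t > 0" for t
    using that by (simp add: h_def flat_exp_def)
  have h_0: "h t = 0" if "t \<le> 0" for t
    using that by (simp add: h_def flat_exp_def)
  define a where "a = h 1 / 2"
  have a: "0 < a" "a < h 1"
    using h_pos[of 1] by (simp_all add: a_def)
  define \<eta> :: "'a \<Rightarrow> real" where "\<eta> p = 1 - inverse (h a) * h (a - h (1 - p \<bullet> p))" for p
  have h_Ck: "Ck k h" for k
    by (simp add: h_def Ck_flat_exp)
  have "Ck k \<eta>" for k
    unfolding \<eta>_def
    by (intro Ck_diff Ck_mult Ck_const Ck_compose[OF h_Ck] Ck_inner_self)
  moreover have "compact (closure {p. \<eta> p \<noteq> 0})"
  proof -
    have "{p. \<eta> p \<noteq> 0} \<subseteq> cball 0 1"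
    proof
      fix p assume "p \<in> {p. \<eta> p \<noteq> 0}"
      then have "p \<bullet> p < 1"
        using h_0[of "1 - p \<bullet> p"] h_pos[OF a(1)] by (force simp: \<eta>_def)
      then show "p \<in> cball 0 1"
        by (simp add: norm_eq_sqrt_inner)
    qed
    then show ?thesis
      by (meson bounded_cball bounded_subset compact_closure)
  qed
  moreover have "\<forall>\<^sub>F p in nhds 0. \<eta> p = 1"
  proof -
    have "continuous_on UNIV (\<lambda>p :: 'a. h (1 - p \<bullet> p))"
      using Ck_compose[OF h_Ck Ck_diff[OF Ck_const Ck_inner_self], of 0 1] by simp
    then have "open {p :: 'a. a < h (1 - p \<bullet> p)}"
      by (intro open_Collect_less continuous_on_const)
    moreover have "0 \<in> {p :: 'a. a < h (1 - p \<bullet> p)}"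
      using a by simp
    ultimately have "\<forall>\<^sub>F p in nhds 0. p \<in> {p :: 'a. a < h (1 - p \<bullet> p)}"
      by (rule eventually_nhds_in_open)
    then show ?thesis
      by eventually_elim (simp add: \<eta>_def h_0)
  qed
  ultimately show ?thesis
    by (auto simp: test_function_def)
qed

section \<open>Gaussian pairings\<close>

lemma std_gaussian_density_eq:
  "std_gaussian_density (p :: 'a::euclidean_space) =
     (1 / sqrt (2 * pi)) ^ DIM('a) * exp ((- 1 / 2) * (p \<bullet> p))"
proof -
  have "(\<Sum>b\<in>Basis. - (p \<bullet> b)\<^sup>2 / 2) = (- 1 / 2) * (p \<bullet> p)"
    by (subst euclidean_inner[of p p]) (simp add: sum_distrib_left power2_eq_square)
  then show ?thesis
    unfolding std_gaussian_density_def normal_density_def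
    by (simp add: prod_dividef exp_sum[symmetric] power_divide)
qed

lemma Ck_std_gaussian_density: "Ck k std_gaussian_density"
  unfolding std_gaussian_density_eq[abs_def]
  by (intro Ck_mult Ck_const Ck_compose[OF Ck_exp] Ck_inner_self)

lemma test_function_truncated_gaussian:
  fixes \<eta> :: "'a::euclidean_space \<Rightarrow> real"
  assumes \<eta>: "test_function \<eta>" and r: "r > 0"
  shows "test_function (\<lambda>p. \<eta> (p /\<^sub>R r) * std_gaussian_density p)"
proof -
  have "Ck k (\<lambda>p. \<eta> (p /\<^sub>R r) * std_gaussian_density p)" for k
    using \<eta> by (intro Ck_mult Ck_scale_arg Ck_std_gaussian_density) (simp add: test_function_def)
  moreover have "bounded {p. \<eta> (p /\<^sub>R r) * std_gaussian_density p \<noteq> 0}"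
  proof (rule bounded_subset)
    have "bounded {p. \<eta> p \<noteq> 0}"
      using \<eta> bounded_subset[OF compact_imp_bounded closure_subset]
      unfolding test_function_def by blast
    then show "bounded ((\<lambda>p. r *\<^sub>R p) ` {p. \<eta> p \<noteq> 0})"
      by (rule bounded_scaling)
    show "{p. \<eta> (p /\<^sub>R r) * std_gaussian_density p \<noteq> 0} \<subseteq> (\<lambda>p. r *\<^sub>R p) ` {p. \<eta> p \<noteq> 0}"
    proof
      fix p assume "p \<in> {p. \<eta> (p /\<^sub>R r) * std_gaussian_density p \<noteq> 0}"
      then have "p = r *\<^sub>R (p /\<^sub>R r)" "\<eta> (p /\<^sub>R r) \<noteq> 0"
        using r by auto
      then show "p \<in> (\<lambda>p. r *\<^sub>R p) ` {p. \<eta> p \<noteq> 0}"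
        by blast
    qed
  qed
  ultimately show ?thesis
    by (simp add: test_function_def)
qed

text \<open>Uniqueness of the pairing rests on the existence of at least one smooth cutoff.\<close>

lemma has_gaussian_pairing_unique:
  assumes "has_gaussian_pairing T c" "has_gaussian_pairing T c'"
  shows "c = c'"
proof -
  obtain \<eta> :: "'a \<Rightarrow> real" where "test_function \<eta> \<and> (\<forall>\<^sub>F p in nhds 0. \<eta> p = 1)"
    using smooth_cutoff_exists by blast
  then show ?thesis
    using assms tendsto_unique[OF trivial_limit_at_top_linorder]
    unfolding has_gaussian_pairing_def by blast
qed

lemma gaussian_pairing_eqI:
  "has_gaussian_pairing T c \<Longrightarrow> gaussian_pairing T = c"
  unfolding gaussian_pairing_def by (blast intro: has_gaussian_pairing_unique the_equality)

lemma has_gaussian_pairing: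
  "gaussian_pairing_finite T \<Longrightarrow> has_gaussian_pairing T (gaussian_pairing T)"
  unfolding gaussian_pairing_finite_def using gaussian_pairing_eqI by blast

lemma has_gaussian_pairing_linear:
  assumes S: "has_gaussian_pairing S c" and T: "has_gaussian_pairing T d"
    and U: "\<And>\<psi>. test_function \<psi> \<Longrightarrow> U \<psi> = S \<psi> * \<alpha> + T \<psi> * \<beta>"
  shows "has_gaussian_pairing U (c * \<alpha> + d * \<beta>)"
  unfolding has_gaussian_pairing_def
proof (intro allI impI)
  fix \<eta> :: "'a \<Rightarrow> real"
  assume \<eta>: "test_function \<eta> \<and> (\<forall>\<^sub>F p in nhds 0. \<eta> p = 1)"
  let ?\<psi> = "\<lambda>r p. \<eta> (p /\<^sub>R r) * std_gaussian_density p"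
  have "((\<lambda>r. S (?\<psi> r) * \<alpha> + T (?\<psi> r) * \<beta>) \<longlongrightarrow> c * \<alpha> + d * \<beta>) at_top"
    using S T \<eta> unfolding has_gaussian_pairing_def by (intro tendsto_intros) blast+
  \<comment> \<open>The identity is known on test functions only; the truncated density is one for \<open>r > 0\<close>.\<close>
  moreover have "\<forall>\<^sub>F r in at_top. S (?\<psi> r) * \<alpha> + T (?\<psi> r) * \<beta> = U (?\<psi> r)"
    using eventually_gt_at_top[of 0]
  proof eventually_elim
    case (elim r)
    with \<eta> show ?case
      using U[OF test_function_truncated_gaussian[of \<eta> r]] by simp
  qed
  ultimately show "((\<lambda>r. U (?\<psi> r)) \<longlongrightarrow> c * \<alpha> + d * \<beta>) at_top"
    by (rule Lim_transform_eventually)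
qed

section \<open>The expected gradient along a fixed direction\<close>

lemma proj_perp_mult: "proj_perp x *v w = w - (x \<bullet> w) *\<^sub>R x"
  by (simp add: proj_perp_def matrix_vector_mult_diff_rdistrib outer_product_mult)

lemma proj_perp_selfadjoint: "(proj_perp x *v w) \<bullet> y = w \<bullet> (proj_perp x *v y)"
  by (simp add: proj_perp_mult inner_diff_left inner_diff_right inner_commute)

text \<open>Stein's identity combined with the chain rule, paired with the Gaussian coordinate by
  coordinate.\<close>

lemma stein_gradient:
  assumes st: "standing_assumption dl Cov x xs"
  shows "(\<integral>p. G_fun dl Cov x xs p *\<^sub>R p \<partial>std_gaussian) =
    E_D1 dl Cov x xs *\<^sub>R (psd_sqrt Cov *v x) + E_D2 dl Cov x xs *\<^sub>R (psd_sqrt Cov *v xs)"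
proof -
  let ?G = "G_fun dl Cov x xs"
  have "gaussian_pairing (distr_deriv b (regular_distr ?G)) =
      (E_D1 dl Cov x xs *\<^sub>R (psd_sqrt Cov *v x) + E_D2 dl Cov x xs *\<^sub>R (psd_sqrt Cov *v xs)) \<bullet> b"
    if b: "b \<in> Basis" for b
  proof -
    have "has_gaussian_pairing (distr_deriv b (regular_distr ?G))
        (E_D1 dl Cov x xs * ((psd_sqrt Cov *v x) \<bullet> b) + E_D2 dl Cov x xs * ((psd_sqrt Cov *v xs) \<bullet> b))"
      unfolding E_D1_def E_D2_def
      by (rule has_gaussian_pairing_linear[OF has_gaussian_pairing has_gaussian_pairing])
        (use st b in \<open>auto simp: standing_assumption_def chain_rule_def\<close>)
    then show ?thesis
      by (simp add: gaussian_pairing_eqI inner_add_left)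
  qed
  then have "(\<Sum>b\<in>Basis. gaussian_pairing (distr_deriv b (regular_distr ?G)) *\<^sub>R b) =
      E_D1 dl Cov x xs *\<^sub>R (psd_sqrt Cov *v x) + E_D2 dl Cov x xs *\<^sub>R (psd_sqrt Cov *v xs)"
    by (simp add: euclidean_representation cong: sum.cong)
  then show ?thesis
    using st by (simp add: standing_assumption_def stein_identity_def)
qed

lemma g_loss_inner:
  fixes Cov :: "real^'n^'n"
  assumes Cov: "pos_semidef Cov" and int: "integrable (gaussian Cov) (g_integrand dl x xs)"
    and st: "standing_assumption dl Cov x xs"
  shows "g_loss dl Cov x xs \<bullet> w =
    E_D1 dl Cov x xs * (x \<bullet> (Cov *v (proj_perp x *v w))) +
    E_D2 dl Cov x xs * (xs \<bullet> (Cov *v (proj_perp x *v w)))"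
proof -
  let ?S = "psd_sqrt Cov" and ?G = "G_fun dl Cov x xs"
  note S = pos_semidef_psd_sqrt[OF Cov]
  have SS: "(?S *v a) \<bullet> (?S *v b) = a \<bullet> (Cov *v b)" for a b
    using pos_semidef_selfadjoint[OF S, of a "?S *v b"]
    by (simp add: matrix_vector_mul_assoc psd_sqrt_square[OF Cov])
  have meas: "(\<lambda>p. ?S *v p) \<in> measurable std_gaussian borel"
    unfolding std_gaussian_def
    by (auto intro!: borel_measurable_continuous_onI continuous_intros)
  have intm: "g_integrand dl x xs \<in> borel_measurable borel"
    using borel_measurable_integrable[OF int] by (simp add: gaussian_def)
  have "g_loss dl Cov x xs \<bullet> w = (\<integral>z. g_integrand dl x xs z \<bullet> w \<partial>gaussian Cov)"
    unfolding g_loss_def using int by simp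
  also have "\<dots> = (\<integral>p. g_integrand dl x xs (?S *v p) \<bullet> w \<partial>std_gaussian)"
    unfolding gaussian_def using intm by (intro integral_distr meas borel_measurable_inner borel_measurable_const)
  also have "\<dots> = (\<integral>p. (?G p *\<^sub>R p) \<bullet> (?S *v (proj_perp x *v w)) \<partial>std_gaussian)"
    by (simp add: g_integrand_def G_fun_def d1_sec_def index_map_def proj_perp_selfadjoint
        pos_semidef_selfadjoint[OF S] matrix_vector_mult_scaleR)
  also have "\<dots> = (\<integral>p. ?G p *\<^sub>R p \<partial>std_gaussian) \<bullet> (?S *v (proj_perp x *v w))"
    using st by (intro integral_inner_left) (simp add: standing_assumption_def)
  finally show ?thesis
    by (simp add: stein_gradient[OF st] inner_add_left SS)
qed

theorem theorem4p13:
  fixes Cov :: "real^'n^'n"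
    and l dl :: "real \<Rightarrow> real \<Rightarrow> real^'n \<Rightarrow> real^'n \<Rightarrow> real"
    and x xs v :: "real^'n"
    and \<theta> \<mu>1 \<mu>2 :: real
  defines "\<theta> \<equiv> arccos (x \<bullet> xs)"
    and "v \<equiv> (proj_perp x *v xs) /\<^sub>R norm (proj_perp x *v xs)"
  assumes "pos_semidef Cov"
    and "xs \<in> sphere 0 1"
    and "\<And>u2 y ys. local_lipschitz {u2} UNIV (\<lambda>t u. l u t y ys)"
    and "is_d1_selection l dl"
    and "\<And>y. y \<in> sphere 0 1 \<Longrightarrow> integrable (gaussian Cov) (g_integrand dl y xs)"
    and "x \<in> sphere 0 1"
    and "\<theta> \<in> {0<..<pi/2}"
    and "standing_assumption dl Cov x xs"
    and "\<mu>1 \<ge> 0" and "\<mu>2 \<ge> 0" and "\<mu>1 + \<mu>2 > 0"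
    and "(E_D1 dl Cov x xs + cos \<theta> * E_D2 dl Cov x xs) * (x \<bullet> (Cov *v v)) \<le> - \<mu>1"
    and "E_D2 dl Cov x xs * (v \<bullet> (Cov *v v)) \<le> - \<mu>2"
  shows "(\<forall>L1>0. (\<forall>y\<in>sphere 0 1. norm (g_loss dl Cov y xs) \<le> L1) \<longrightarrow>
            g_loss dl Cov x xs \<bullet> xs
              \<le> - ((\<mu>1 + sin \<theta> * \<mu>2) / L1) * sin \<theta> * norm (g_loss dl Cov x xs)) \<and>
         (\<forall>L2>0. (\<forall>y\<in>sphere 0 1. norm (g_loss dl Cov y xs) \<le> L2 * norm (y - xs)) \<longrightarrow>
            g_loss dl Cov x xs \<bullet> xs
              \<le> - ((\<mu>1 + sin \<theta> * \<mu>2) / (2 * L2)) * norm (g_loss dl Cov x xs))"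
proof -
  define s where "s = sin \<theta>"
  define w where "w = proj_perp x *v xs"
  define a where "a = \<mu>1 + s * \<mu>2"
  let ?g = "g_loss dl Cov x xs"
  have xx: "x \<bullet> x = 1" and ss: "xs \<bullet> xs = 1"
    using \<open>x \<in> sphere 0 1\<close> \<open>xs \<in> sphere 0 1\<close> by (simp_all add: dot_square_norm)
  have le1: "\<bar>x \<bullet> xs\<bar> \<le> 1"
    using Cauchy_Schwarz_ineq2[of x xs] \<open>x \<in> sphere 0 1\<close> \<open>xs \<in> sphere 0 1\<close> by simp
  have cos: "cos \<theta> = x \<bullet> xs"
    unfolding \<theta>_def using le1 by (simp add: cos_arccos_abs)
  have \<theta>: "0 < \<theta>" "\<theta> < pi / 2"
    using assms(9) by auto
  have s: "0 < s"
    unfolding s_def using \<theta> by (intro sin_gt_zero) auto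
  have "s\<^sup>2 = 1 - (x \<bullet> xs)\<^sup>2"
    by (simp add: s_def sin_squared_eq cos)
  then have "w \<bullet> w = s\<^sup>2"
    using xx ss by (simp add: w_def proj_perp_mult inner_diff_left inner_diff_right
        inner_commute[of xs x] power2_eq_square)
  then have norm_w: "norm w = s"
    using s by (simp add: norm_eq_sqrt_inner)
  have w: "w = s *\<^sub>R v"
    using s norm_w by (simp add: v_def w_def)
  have xs: "xs = cos \<theta> *\<^sub>R x + s *\<^sub>R v"
    unfolding w[symmetric] by (simp add: w_def proj_perp_mult cos)
  have "?g \<bullet> xs = E_D1 dl Cov x xs * (x \<bullet> (Cov *v w)) + E_D2 dl Cov x xs * (xs \<bullet> (Cov *v w))"
    unfolding w_def using assms by (intro g_loss_inner) auto
  also have "xs \<bullet> (Cov *v w) = cos \<theta> * (x \<bullet> (Cov *v w)) + s * (v \<bullet> (Cov *v w))"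
    by (subst (1) xs) (simp add: inner_add_left)
  finally have "?g \<bullet> xs = s * ((E_D1 dl Cov x xs + cos \<theta> * E_D2 dl Cov x xs) * (x \<bullet> (Cov *v v)) +
      s * (E_D2 dl Cov x xs * (v \<bullet> (Cov *v v))))"
    by (simp add: w matrix_vector_mult_scaleR algebra_simps)
  also have "\<dots> \<le> s * (- \<mu>1 + s * (- \<mu>2))"
    using assms s by (intro mult_left_mono add_mono) auto
  finally have main: "?g \<bullet> xs \<le> - (a * s)"
    by (simp add: a_def algebra_simps)
  have a: "0 \<le> a"
    using assms s by (simp add: a_def)
  show ?thesis
    unfolding s_def[symmetric] a_def[symmetric]
  proof (intro conjI allI impI)
    fix L1 :: real
    assume L1: "L1 > 0" and bound: "\<forall>y\<in>sphere 0 1. norm (g_loss dl Cov y xs) \<le> L1"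
    have "norm ?g / L1 \<le> 1"
      using bound L1 \<open>x \<in> sphere 0 1\<close> by simp
    then have "a * s * (norm ?g / L1) \<le> a * s"
      using a s by (intro mult_left_le) auto
    with main show "?g \<bullet> xs \<le> - (a / L1) * s * norm ?g"
      by (simp add: mult_ac)
  next
    fix L2 :: real
    assume L2: "L2 > 0" and bound: "\<forall>y\<in>sphere 0 1. norm (g_loss dl Cov y xs) \<le> L2 * norm (y - xs)"
    \<comment> \<open>The factor \<open>2 (1 + cos \<theta>) \<ge> 1\<close> turns \<open>2 (1 - cos \<theta>)\<close> into \<open>4 sin\<^sup>2 \<theta>\<close>.\<close>
    have "(norm (x - xs))\<^sup>2 = 2 * (1 - cos \<theta>)"
      using xx ss by (simp add: power2_norm_eq_inner inner_diff_left inner_diff_right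
          inner_commute[of xs x] cos)
    also have "\<dots> \<le> 2 * (1 - cos \<theta>) * (2 * (1 + cos \<theta>))"
      using mult_left_mono[of 1 "2 * (1 + cos \<theta>)" "2 * (1 - cos \<theta>)"] \<theta> cos_gt_zero[of \<theta>]
      by simp
    also have "\<dots> = (2 * s)\<^sup>2"
      by (simp add: s_def power_mult_distrib sin_squared_eq) (simp add: algebra_simps power2_eq_square)
    finally have "(norm (x - xs))\<^sup>2 \<le> (2 * s)\<^sup>2" .
    then have "norm (x - xs) \<le> 2 * s"
      by (rule power2_le_imp_le) (use s in simp)
    then have "L2 * norm (x - xs) \<le> L2 * (2 * s)"
      using L2 by (intro mult_left_mono) simp_all
    with bspec[OF bound \<open>x \<in> sphere 0 1\<close>] have "norm ?g \<le> L2 * (2 * s)"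
      by (rule order_trans)
    then have "norm ?g / (2 * L2) \<le> s"
      using L2 by (simp add: divide_le_eq mult_ac)
    then have "a * (norm ?g / (2 * L2)) \<le> a * s"
      using a by (intro mult_left_mono)
    with main show "?g \<bullet> xs \<le> - (a / (2 * L2)) * norm ?g"
      by simp
  qed
qed

end
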